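(* Let $1\le n\le M$. If there exists a solution of the fully discrete problem (defined in the context) such that $|\boldsymbol{\tau}_h^{n}-\boldsymbol{\tau}_h^{n-1}|^2<2$ (on every element $[u_i,u_{i+1}]$), then, on every element, $$ |\boldsymbol{x}_{h,u}^0|\;\le\;|\boldsymbol{x}_{h,u}^{n}|\;=\;\frac{|\boldsymbol{x}_{h,u}^0|}{1-\frac12|\boldsymbol{\tau}_h^{n}-\boldsymbol{\tau}_h^{n-1}|^2}. $$
   Context: Subscript $u$ denotes the derivative in $u\in[0,1]$; integrals are with respect to $du$. $\mathbb{I}$ is the $3\times3$ identity matrix and $(\boldsymbol a\otimes\boldsymbol b)_{ij}=a_ib_j$. Data: $\mathbb{K}$ is a strictly positive definite $3\times3$ matrix; $K^{\mathrm{rot}}>0$; $A=A(u)\ge A_0>0$, $B=B(u)\ge0$, $C=C(u)>C_0>0$, $D=D(u)\ge0$ are material parameters; $\alpha^0,\beta^0,\gamma^0$ are given real-valued fields depending on $u$ and $t$ (preferred curvatures and twist). Finite element spaces: $0=u_1<u_2<\dots<u_N=1$; $V_h=\{v\in C([0,1]): v|_{[u_i,u_{i+1}]}\text{ affine}\}$, $Q_h=\{q\in L^2(0,1): q|_{[u_i,u_{i+1}]}\text{ constant}\}$ ($i=1,\dots,N-1$), $V_{h,0}=\{v\in V_h:v(0)=v(1)=0\}$; $(f)_h:=I_h(f)$ with $I_h$ the Lagrange (nodal) interpolation operator onto $V_h$. Time steps: $t_n=n\Delta t$, $n=0,\dots,M$, $t_M=T$; superscript $n$ denotes a quantity at $t_n$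 and $\bar\partial\eta^n=(\eta^n-\eta^{n-1})/\Delta t$. Tangents: $\boldsymbol{\tau}_h^n=\boldsymbol{x}^n_{h,u}/|\boldsymbol{x}^n_{h,u}|\in Q_h^3$ (with $|\boldsymbol{x}^n_{h,u}|>0$ on each element, including $n=0$); $\tilde{\boldsymbol{\tau}}^n_h\in V_h^3$ has vertex values $\tilde{\boldsymbol{\tau}}^n_h(u_i)=\dfrac{\boldsymbol{\tau}^n_h(u_i^-)+\boldsymbol{\tau}^n_h(u_i^+)}{|\boldsymbol{\tau}^n_h(u_i^-)+\boldsymbol{\tau}^n_h(u_i^+)|}$, where $u_i^\pm$ refer to the element right/left of $u_i$ (only the one adjacent element being used at end points). Set $\boldsymbol{\kappa}_b^n=\alpha^0(\cdot,t_n)\boldsymbol{e}^{1,n-1}_h+\beta^0(\cdot,t_n)\boldsymbol{e}^{2,n-1}_h$; $V_{h,0}^3+\boldsymbol{\kappa}_b^n$ denotes the functions in $V_h^3$ equal to $\boldsymbol{\kappa}_b^n$ at $u=0,1$. Fully discrete problem: given $\boldsymbol{x}_h^0,\boldsymbol{e}_h^{1,0},\boldsymbol{e}_h^{2,0}\in V_h^3$, define $\boldsymbol{\kappa}_h^0\in V_{h,0}^3$ and $\gamma^0_h\in V_h$ by $\int_0^1\boldsymbol{\kappa}_h^0\cdot\boldsymbol{\psi}_h|\boldsymbol{x}^0_{h,u}|+\frac{\boldsymbol{x}^0_{h,u}}{|\boldsymbol{x}^0_{h,u}|}\cdot\boldsymbol{\psi}_{h,u}=0$ for all $\boldsymbol{\psi}_h\in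 V_{h,0}^3$ and $\int_0^1\bigl(\gamma_h^0-\frac{\boldsymbol{e}^{1,0}_{h,u}}{|\boldsymbol{x}^0_{h,u}|}\cdot\boldsymbol{e}^{2,0}_h\bigr)v_h|\boldsymbol{x}^0_{h,u}|=0$ for all $v_h\in V_h$; starting values $\boldsymbol{y}_h^0\in V_{h,0}^3$, $m_h^0\in V_h$ are also taken as given. For $n=1,\dots,M$ find $\boldsymbol{x}_h^n\in V_h^3$, $\boldsymbol{y}_h^n\in V_{h,0}^3$, $\boldsymbol{\kappa}_h^n\in V_{h,0}^3+\boldsymbol{\kappa}_b^n$, $m_h^n\in V_h$, $z_h^n,\gamma_h^n,p_h^n\in Q_h$, $\boldsymbol{e}^{1,n}_h,\boldsymbol{e}^{2,n}_h\in V_h^3$ such that for all $\boldsymbol{\phi}_h\in V_h^3$, $\boldsymbol{\psi}_h\in V_{h,0}^3$, $v_h\in V_h$, $q_h\in Q_h$: (1) $\int_0^1\mathbb{K}\bar\partial\boldsymbol{x}_h^n\cdot\boldsymbol{\phi}_h|\boldsymbol{x}^{n-1}_{h,u}|-\int_0^1p^n_h\boldsymbol{\tau}_h^{n-1}\cdot\boldsymbol{\phi}_{h,u}-\int_0^1\bigl((\mathbb{I}-\boldsymbol{\tau}_h^{n-1}\otimes\boldsymbol{\tau}_h^{n-1})\frac{\boldsymbol{y}^n_{h,u}}{|\boldsymbol{x}^{n-1}_{h,u}|}+z_h^n\boldsymbol{\tau}_h^{n-1}\times\boldsymbol{\kappa}_h^{n-1}\bigr)\cdot\boldsymbol{\phi}_{h,u}=0$;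 (2) $\int_0^1\bigl(\boldsymbol{y}_h^n-A(\boldsymbol{\kappa}_h^n-\alpha^0(\cdot,t_n)\boldsymbol{e}^{1,n-1}_h-\beta^0(\cdot,t_n)\boldsymbol{e}^{2,n-1}_h)-B\bigl((\mathbb{I}-\tilde{\boldsymbol{\tau}}_h^{n-1}\otimes\tilde{\boldsymbol{\tau}}_h^{n-1})\bar\partial\boldsymbol{\kappa}_h^n-m_h^{n-1}\tilde{\boldsymbol{\tau}}_h^{n-1}\times\boldsymbol{\kappa}_h^n\bigr)_h\bigr)\cdot\boldsymbol{\psi}_h|\boldsymbol{x}^{n-1}_{h,u}|=0$; (3) $\int_0^1\boldsymbol{\kappa}_h^n\cdot\boldsymbol{\psi}_h|\boldsymbol{x}^{n-1}_{h,u}|+\frac{1}{|\boldsymbol{x}^{n-1}_{h,u}|}\boldsymbol{x}^n_{h,u}\cdot\boldsymbol{\psi}_{h,u}=0$; (4) $-\int_0^1K^{\mathrm{rot}}m_h^nv_h|\boldsymbol{x}^{n-1}_{h,u}|-\int_0^1z_h^nv_{h,u}+\int_0^1\boldsymbol{y}_h^{n-1}\cdot(\tilde{\boldsymbol{\tau}}_h^{n-1}\times\boldsymbol{\kappa}_h^{n-1})v_h|\boldsymbol{x}^{n-1}_{h,u}|=0$; (5) $\int_0^1(z_h^n-C(\gamma_h^n-\gamma^0(\cdot,t_n))-D\bar\partial\gamma_h^n)q_h|\boldsymbol{x}^{n-1}_{h,u}|=0$; (6) $\int_0^1\bar\partial\gamma_h^nq_h|\boldsymbol{x}^{n-1}_{h,u}|-\int_0^1m^n_{h,u}q_h+\int_0^1(\boldsymbol{\tau}_h^{n-1}\times\boldsymbol{\kappa}_h^{n-1})\cdot\bar\partial\boldsymbol{x}^n_{h,u}\,q_h=0$;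 (7) $\int_0^1q_h\boldsymbol{\tau}_h^{n-1}\cdot\boldsymbol{x}^n_{h,u}=\int_0^1|\boldsymbol{x}^0_{h,u}|q_h$; (8) the frame is updated at each vertex $u_i$, with $\boldsymbol{k}_i^n=\tilde{\boldsymbol{\tau}}^{n-1}_h(u_i)\times\tilde{\boldsymbol{\tau}}^n_h(u_i)$, $\boldsymbol{l}_i^n=\tilde{\boldsymbol{\tau}}^n_h(u_i)$, $\varphi_i^n=\Delta t\,m_h^n(u_i)$, for $j=1,2$, by $\tilde{\boldsymbol{e}}^{j,n}_h(u_i)=\boldsymbol{e}^{j,n-1}_h(u_i)(\tilde{\boldsymbol{\tau}}^{n-1}_h(u_i)\cdot\tilde{\boldsymbol{\tau}}^n_h(u_i))+\boldsymbol{k}_i^n\times\boldsymbol{e}^{j,n-1}_h(u_i)+\dfrac{(\boldsymbol{e}^{j,n-1}_h(u_i)\cdot\boldsymbol{k}_i^n)\boldsymbol{k}_i^n}{1+\tilde{\boldsymbol{\tau}}^{n-1}_h(u_i)\cdot\tilde{\boldsymbol{\tau}}^n_h(u_i)}$ and $\boldsymbol{e}^{j,n}_h(u_i)=\tilde{\boldsymbol{e}}^{j,n}_h(u_i)\cos\varphi_i^n+\boldsymbol{l}_i^n\times\tilde{\boldsymbol{e}}^{j,n}_h(u_i)\sin\varphi_i^n+(\tilde{\boldsymbol{e}}^{j,n}_h(u_i)\cdot\boldsymbol{l}_i^n)\boldsymbol{l}_i^n(1-\cos\varphi_i^n)$. *)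

theory Defs
  imports "HOL-Analysis.Analysis"
begin

unbundle cross3_syntax

section \<open>Data of the problem\<close>

text \<open>
  \<open>N\<close>, \<open>node\<close>: the mesh \<open>0 = u_1 < \<dots> < u_N = 1\<close>; \<open>M\<close>, \<open>\<Delta>t\<close>, \<open>T\<close>: the time grid;
  \<open>\<alpha>0\<close>, \<open>\<beta>0\<close>, \<open>\<gamma>0\<close>: preferred curvatures and twist, as functions of \<open>u\<close> and then \<open>t\<close>
  (not to be confused with the discrete twist \<open>\<gamma>\<^sub>h\<close> at time level 0).
\<close>

record rod_data =
  N :: nat
  node :: "nat \<Rightarrow> real"
  M :: nat
  \<Delta>t :: real
  T :: real
  Kmat :: "real^3^3"
  Krot :: real
  Acoef :: "real \<Rightarrow> real"
  Amin :: real
  Bcoef :: "real \<Rightarrow> real"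
  Ccoef :: "real \<Rightarrow> real"
  Cmin :: real
  Dcoef :: "real \<Rightarrow> real"
  \<alpha>0 :: "real \<Rightarrow> real \<Rightarrow> real"
  \<beta>0 :: "real \<Rightarrow> real \<Rightarrow> real"
  \<gamma>0 :: "real \<Rightarrow> real \<Rightarrow> real"

definition valid_mesh :: "rod_data \<Rightarrow> bool" where
  "valid_mesh P \<longleftrightarrow>
     2 \<le> N P \<and> node P 1 = 0 \<and> node P (N P) = 1 \<and> strict_mono_on {1..N P} (node P)"

definition time :: "rod_data \<Rightarrow> nat \<Rightarrow> real" where
  "time P n = real n * \<Delta>t P"

definition valid_data :: "rod_data \<Rightarrow> bool" where
  "valid_data P \<longleftrightarrow>
     valid_mesh P \<and>
     0 < \<Delta>t P \<and> time P (M P) = T P \<and>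
     (\<forall>v. v \<noteq> 0 \<longrightarrow> 0 < v \<bullet> (Kmat P *v v)) \<and>
     0 < Krot P \<and>
     0 < Amin P \<and> (\<forall>u\<in>{0..1}. Amin P \<le> Acoef P u) \<and>
     (\<forall>u\<in>{0..1}. 0 \<le> Bcoef P u) \<and>
     0 < Cmin P \<and> (\<forall>u\<in>{0..1}. Cmin P < Ccoef P u) \<and>
     (\<forall>u\<in>{0..1}. 0 \<le> Dcoef P u)"


section \<open>Finite element spaces\<close>

definition elem :: "rod_data \<Rightarrow> nat \<Rightarrow> real set" where
  "elem P i = {node P i <..< node P (Suc i)}"

text \<open>
  All spaces are polymorphic in the range, so that \<open>V\<^sub>h P\<close> stands both for the scalar space and
  for its vector-valued version. Only the values of the functions on \<open>{0..1}\<close> matter.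
\<close>

definition V\<^sub>h :: "rod_data \<Rightarrow> (real \<Rightarrow> 'a::real_normed_vector) set" where
  "V\<^sub>h P = {v. continuous_on {0..1} v \<and>
     (\<forall>i\<in>{1..<N P}. \<exists>a b. \<forall>u\<in>{node P i..node P (Suc i)}. v u = a + u *\<^sub>R b)}"

definition V\<^sub>h\<^sub>0 :: "rod_data \<Rightarrow> (real \<Rightarrow> 'a::real_normed_vector) set" where
  "V\<^sub>h\<^sub>0 P = {v \<in> V\<^sub>h P. v 0 = 0 \<and> v 1 = 0}"

text \<open>
  Elements of \<open>Q\<^sub>h\<close> are classes of functions modulo null sets; hence the values at the finitely
  many nodes are left unconstrained.
\<close>

definition Q\<^sub>h :: "rod_data \<Rightarrow> (real \<Rightarrow> 'a::real_normed_vector) set" where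
  "Q\<^sub>h P = {q. \<forall>i\<in>{1..<N P}. \<exists>c. \<forall>u\<in>elem P i. q u = c}"

text \<open>
  On \<open>{0..1}\<close> the choice below is unique. The Lagrange interpolant of \<open>f\<close> is the case
  \<open>c i = f (node P i)\<close>.
\<close>

definition nodal_interp :: "rod_data \<Rightarrow> (nat \<Rightarrow> 'a::real_normed_vector) \<Rightarrow> real \<Rightarrow> 'a" where
  "nodal_interp P c = (SOME v. v \<in> V\<^sub>h P \<and> (\<forall>i\<in>{1..N P}. v (node P i) = c i))"

definition I\<^sub>h :: "rod_data \<Rightarrow> (real \<Rightarrow> 'a::real_normed_vector) \<Rightarrow> real \<Rightarrow> 'a" where
  "I\<^sub>h P f = nodal_interp P (\<lambda>i. f (node P i))"

lemma nodal_interp_exists: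
  fixes c :: "nat \<Rightarrow> 'a::real_normed_vector"
  assumes mesh: "valid_mesh P"
  shows "\<exists>v \<in> V\<^sub>h P. \<forall>i\<in>{1..N P}. v (node P i) = c i"
proof -
  have less: "node P i < node P j" if "1 \<le> i" "i < j" "j \<le> N P" for i j
    using mesh that by (auto simp: valid_mesh_def strict_mono_on_def)
  have le: "node P i \<le> node P j" if "1 \<le> i" "i \<le> j" "j \<le> N P" for i j
    using less[of i j] that by (cases "i = j") auto
  define w where "w i u = max 0 (min 1 ((u - node P i) / (node P (Suc i) - node P i)))" for i u
  define v where "v u = c 1 + (\<Sum>i\<in>{1..<N P}. w i u *\<^sub>R (c (Suc i) - c i))" for u
  have pos: "0 < node P (Suc i) - node P i" if "1 \<le> i" "i < N P" for i
    using less[of i "Suc i"] that by simp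
  have w0: "w i u = 0" if "1 \<le> i" "i < N P" "u \<le> node P i" for i u
  proof -
    have "(u - node P i) / (node P (Suc i) - node P i) \<le> 0"
      using pos[of i] that by (intro divide_nonpos_pos) simp_all
    then show ?thesis unfolding w_def by linarith
  qed
  have w1: "w i u = 1" if "1 \<le> i" "i < N P" "node P (Suc i) \<le> u" for i u
  proof -
    have "1 \<le> (u - node P i) / (node P (Suc i) - node P i)"
      using pos[of i] that by (simp add: le_divide_eq_1_pos)
    then show ?thesis unfolding w_def by linarith
  qed
  have waff: "w i u = (u - node P i) / (node P (Suc i) - node P i)"
    if "1 \<le> i" "i < N P" "u \<in> {node P i..node P (Suc i)}" for i u
  proof -
    have "0 \<le> (u - node P i) / (node P (Suc i) - node P i)"
      using pos[of i] that by (intro divide_nonneg_pos) simp_all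
    moreover have "(u - node P i) / (node P (Suc i) - node P i) \<le> 1"
      using pos[of i] that by (simp add: divide_le_eq_1_pos)
    ultimately show ?thesis unfolding w_def by linarith
  qed
  have "v \<in> V\<^sub>h P"
    unfolding V\<^sub>h_def
  proof (intro CollectI conjI ballI)
    show "continuous_on {0..1} v"
      unfolding v_def w_def divide_inverse
      by (intro continuous_intros)
  next
    fix k assume k: "k \<in> {1..<N P}"
    have "\<exists>a b. \<forall>u\<in>{node P k..node P (Suc k)}. w i u *\<^sub>R (c (Suc i) - c i) = a + u *\<^sub>R b"
      if i: "i \<in> {1..<N P}" for i
    proof -
      consider "i < k" | "i = k" | "k < i" by linarith
      then show ?thesis
      proof cases
        case 1
        then have "w i u = 1" if "u \<in> {node P k..node P (Suc k)}" for u
          using w1[of i u] le[of "Suc i" k] i k that by auto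
        then show ?thesis by (intro exI[of _ "c (Suc i) - c i"] exI[of _ 0]) auto
      next
        case 2
        let ?h = "node P (Suc k) - node P k"
        let ?d = "c (Suc k) - c k"
        have "w i u *\<^sub>R (c (Suc i) - c i) = (- node P k / ?h) *\<^sub>R ?d + u *\<^sub>R ((1 / ?h) *\<^sub>R ?d)"
          if "u \<in> {node P k..node P (Suc k)}" for u
          using waff[of k u] k that 2
          by (simp add: diff_divide_distrib scaleR_left.diff)
        then show ?thesis by blast
      next
        case 3
        then have "w i u = 0" if "u \<in> {node P k..node P (Suc k)}" for u
          using w0[of i u] le[of "Suc k" i] i k that by auto
        then show ?thesis by (intro exI[of _ 0]) auto
      qed
    qed
    then obtain a b where ab: "\<And>i u. i \<in> {1..<N P} \<Longrightarrow> u \<in> {node P k..node P (Suc k)} \<Longrightarrow>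
        w i u *\<^sub>R (c (Suc i) - c i) = a i + u *\<^sub>R b i"
      by metis
    have "v u = (c 1 + sum a {1..<N P}) + u *\<^sub>R sum b {1..<N P}"
      if "u \<in> {node P k..node P (Suc k)}" for u
      unfolding v_def using ab that
      by (simp add: sum.distrib scaleR_sum_right)
    then show "\<exists>a b. \<forall>u\<in>{node P k..node P (Suc k)}. v u = a + u *\<^sub>R b" by blast
  qed
  moreover have "v (node P k) = c k" if k: "k \<in> {1..N P}" for k
  proof -
    have "(\<Sum>i\<in>{1..<N P}. w i (node P k) *\<^sub>R (c (Suc i) - c i)) =
          (\<Sum>i\<in>{1..<N P}. if i < k then c (Suc i) - c i else 0)"
    proof (rule sum.cong[OF refl])
      fix i assume i: "i \<in> {1..<N P}"
      show "w i (node P k) *\<^sub>R (c (Suc i) - c i) = (if i < k then c (Suc i) - c i else 0)"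
        using w0[of i "node P k"] w1[of i "node P k"] le[of k i] le[of "Suc i" k] i k by auto
    qed
    also have "\<dots> = (\<Sum>i\<in>{1..<k}. c (Suc i) - c i)"
      using k by (intro sum.mono_neutral_cong_right) auto
    also have "\<dots> = c k - c 1"
      using k by (intro sum_Suc_diff') auto
    finally show ?thesis unfolding v_def by simp
  qed
  ultimately show ?thesis by blast
qed

lemma nodal_interp:
  assumes "valid_mesh P"
  shows "nodal_interp P c \<in> V\<^sub>h P" "i \<in> {1..N P} \<Longrightarrow> nodal_interp P c (node P i) = c i"
proof -
  have "\<exists>v. v \<in> V\<^sub>h P \<and> (\<forall>i\<in>{1..N P}. v (node P i) = c i)"
    using nodal_interp_exists[OF assms] by blast
  then have "nodal_interp P c \<in> V\<^sub>h P \<and> (\<forall>i\<in>{1..N P}. nodal_interp P c (node P i) = c i)"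
    unfolding nodal_interp_def by (rule someI_ex)
  then show "nodal_interp P c \<in> V\<^sub>h P" "i \<in> {1..N P} \<Longrightarrow> nodal_interp P c (node P i) = c i"
    by auto
qed


section \<open>Derivatives, tangents, and the backward difference quotient\<close>

text \<open>
  For a function in \<open>V\<^sub>h P\<close> this is its derivative on each open element; the nodes form a null
  set, where the value may be arbitrary.
\<close>

definition du :: "(real \<Rightarrow> 'a::real_normed_vector) \<Rightarrow> real \<Rightarrow> 'a" where
  "du f u = vector_derivative f (at u)"

definition \<tau>\<^sub>h :: "(real \<Rightarrow> real^3) \<Rightarrow> real \<Rightarrow> real^3" where
  "\<tau>\<^sub>h x u = du x u /\<^sub>R norm (du x u)"

definition vertex_tangent :: "rod_data \<Rightarrow> (real \<Rightarrow> real^3) \<Rightarrow> nat \<Rightarrow> real^3" where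
  "vertex_tangent P x i =
     (let s = (if i = 1 then 0 else Lim (at_left (node P i)) (\<tau>\<^sub>h x)) +
              (if i = N P then 0 else Lim (at_right (node P i)) (\<tau>\<^sub>h x))
      in s /\<^sub>R norm s)"

definition \<tau>tilde\<^sub>h :: "rod_data \<Rightarrow> (real \<Rightarrow> real^3) \<Rightarrow> real \<Rightarrow> real^3" where
  "\<tau>tilde\<^sub>h P x = nodal_interp P (vertex_tangent P x)"

definition bdiff :: "rod_data \<Rightarrow> (nat \<Rightarrow> real \<Rightarrow> 'a::real_normed_vector) \<Rightarrow> nat \<Rightarrow> real \<Rightarrow> 'a" where
  "bdiff P \<eta> n u = (\<eta> n u - \<eta> (n - 1) u) /\<^sub>R \<Delta>t P"

definition outer :: "real^3 \<Rightarrow> real^3 \<Rightarrow> real^3^3" where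
  "outer a b = (\<chi> i j. a $ i * b $ j)"

definition proj :: "real^3 \<Rightarrow> real^3^3" where
  "proj t = mat 1 - outer t t"


section \<open>The fully discrete problem\<close>

text \<open>The first argument of each field is the time level.\<close>

record rod_fields =
  x\<^sub>h :: "nat \<Rightarrow> real \<Rightarrow> real^3"
  y\<^sub>h :: "nat \<Rightarrow> real \<Rightarrow> real^3"
  \<kappa>\<^sub>h :: "nat \<Rightarrow> real \<Rightarrow> real^3"
  m\<^sub>h :: "nat \<Rightarrow> real \<Rightarrow> real"
  z\<^sub>h :: "nat \<Rightarrow> real \<Rightarrow> real"
  \<gamma>\<^sub>h :: "nat \<Rightarrow> real \<Rightarrow> real"
  p\<^sub>h :: "nat \<Rightarrow> real \<Rightarrow> real"
  e1\<^sub>h :: "nat \<Rightarrow> real \<Rightarrow> real^3"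
  e2\<^sub>h :: "nat \<Rightarrow> real \<Rightarrow> real^3"

definition speed :: "rod_fields \<Rightarrow> nat \<Rightarrow> real \<Rightarrow> real" where
  "speed S n u = norm (du (x\<^sub>h S n) u)"

definition \<tau>\<^sub>n :: "rod_fields \<Rightarrow> nat \<Rightarrow> real \<Rightarrow> real^3" where
  "\<tau>\<^sub>n S n = \<tau>\<^sub>h (x\<^sub>h S n)"

definition \<tau>tilde\<^sub>n :: "rod_data \<Rightarrow> rod_fields \<Rightarrow> nat \<Rightarrow> real \<Rightarrow> real^3" where
  "\<tau>tilde\<^sub>n P S n = \<tau>tilde\<^sub>h P (x\<^sub>h S n)"

definition \<kappa>\<^sub>b :: "rod_data \<Rightarrow> rod_fields \<Rightarrow> nat \<Rightarrow> real \<Rightarrow> real^3" where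
  "\<kappa>\<^sub>b P S n u = \<alpha>0 P u (time P n) *\<^sub>R e1\<^sub>h S (n - 1) u + \<beta>0 P u (time P n) *\<^sub>R e2\<^sub>h S (n - 1) u"

definition initial_values :: "rod_data \<Rightarrow> rod_fields \<Rightarrow> bool" where
  "initial_values P S \<longleftrightarrow>
     x\<^sub>h S 0 \<in> V\<^sub>h P \<and> e1\<^sub>h S 0 \<in> V\<^sub>h P \<and> e2\<^sub>h S 0 \<in> V\<^sub>h P \<and>
     y\<^sub>h S 0 \<in> V\<^sub>h\<^sub>0 P \<and> m\<^sub>h S 0 \<in> V\<^sub>h P \<and>
     \<kappa>\<^sub>h S 0 \<in> V\<^sub>h\<^sub>0 P \<and>
     (\<forall>\<psi>\<in>V\<^sub>h\<^sub>0 P. integral {0..1} (\<lambda>u. (\<kappa>\<^sub>h S 0 u \<bullet> \<psi> u) * speed S 0 u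
          + (du (x\<^sub>h S 0) u /\<^sub>R speed S 0 u) \<bullet> du \<psi> u) = 0) \<and>
     \<gamma>\<^sub>h S 0 \<in> V\<^sub>h P \<and>
     (\<forall>v\<in>V\<^sub>h P. integral {0..1} (\<lambda>u. (\<gamma>\<^sub>h S 0 u
          - (du (e1\<^sub>h S 0) u /\<^sub>R speed S 0 u) \<bullet> e2\<^sub>h S 0 u) * v u * speed S 0 u) = 0)"

definition in_spaces :: "rod_data \<Rightarrow> rod_fields \<Rightarrow> nat \<Rightarrow> bool" where
  "in_spaces P S n \<longleftrightarrow>
     x\<^sub>h S n \<in> V\<^sub>h P \<and> y\<^sub>h S n \<in> V\<^sub>h\<^sub>0 P \<and>
     \<kappa>\<^sub>h S n \<in> V\<^sub>h P \<and> \<kappa>\<^sub>h S n 0 = \<kappa>\<^sub>b P S n 0 \<and> \<kappa>\<^sub>h S n 1 = \<kappa>\<^sub>b P S n 1 \<and>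
     m\<^sub>h S n \<in> V\<^sub>h P \<and> z\<^sub>h S n \<in> Q\<^sub>h P \<and> \<gamma>\<^sub>h S n \<in> Q\<^sub>h P \<and> p\<^sub>h S n \<in> Q\<^sub>h P \<and>
     e1\<^sub>h S n \<in> V\<^sub>h P \<and> e2\<^sub>h S n \<in> V\<^sub>h P"

definition momentum_eq :: "rod_data \<Rightarrow> rod_fields \<Rightarrow> nat \<Rightarrow> bool" where
  "momentum_eq P S n \<longleftrightarrow> (\<forall>\<phi>\<in>V\<^sub>h P.
       integral {0..1} (\<lambda>u. ((Kmat P *v bdiff P (x\<^sub>h S) n u) \<bullet> \<phi> u) * speed S (n - 1) u)
     - integral {0..1} (\<lambda>u. (p\<^sub>h S n u *\<^sub>R \<tau>\<^sub>n S (n - 1) u) \<bullet> du \<phi> u)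
     - integral {0..1} (\<lambda>u.
         (proj (\<tau>\<^sub>n S (n - 1) u) *v (du (y\<^sub>h S n) u /\<^sub>R speed S (n - 1) u)
          + z\<^sub>h S n u *\<^sub>R (\<tau>\<^sub>n S (n - 1) u \<times> \<kappa>\<^sub>h S (n - 1) u)) \<bullet> du \<phi> u) = 0)"

text \<open>
  The constitutive laws below are the only equations involving the material parameters and the
  preferred curvatures and twist, on whose regularity in \<open>u\<close> nothing is assumed; therefore
  existence of the integral is stated explicitly (all other integrands are piecewise polynomial).
\<close>

definition bending_integrand :: "rod_data \<Rightarrow> rod_fields \<Rightarrow> nat \<Rightarrow> (real \<Rightarrow> real^3) \<Rightarrow> real \<Rightarrow> real" where
  "bending_integrand P S n \<psi> u =
     ((y\<^sub>h S n u
       - Acoef P u *\<^sub>R (\<kappa>\<^sub>h S n u - \<alpha>0 P u (time P n) *\<^sub>R e1\<^sub>h S (n - 1) u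
                                - \<beta>0 P u (time P n) *\<^sub>R e2\<^sub>h S (n - 1) u)
       - Bcoef P u *\<^sub>R I\<^sub>h P (\<lambda>s.
           proj (\<tau>tilde\<^sub>n P S (n - 1) s) *v bdiff P (\<kappa>\<^sub>h S) n s
           - m\<^sub>h S (n - 1) s *\<^sub>R (\<tau>tilde\<^sub>n P S (n - 1) s \<times> \<kappa>\<^sub>h S n s)) u) \<bullet> \<psi> u)
     * speed S (n - 1) u"

definition bending_eq :: "rod_data \<Rightarrow> rod_fields \<Rightarrow> nat \<Rightarrow> bool" where
  "bending_eq P S n \<longleftrightarrow> (\<forall>\<psi>\<in>V\<^sub>h\<^sub>0 P.
     bending_integrand P S n \<psi> absolutely_integrable_on {0..1} \<and>
     integral {0..1} (bending_integrand P S n \<psi>) = 0)"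

definition curvature_eq :: "rod_data \<Rightarrow> rod_fields \<Rightarrow> nat \<Rightarrow> bool" where
  "curvature_eq P S n \<longleftrightarrow> (\<forall>\<psi>\<in>V\<^sub>h\<^sub>0 P.
     integral {0..1} (\<lambda>u. (\<kappa>\<^sub>h S n u \<bullet> \<psi> u) * speed S (n - 1) u
       + (1 / speed S (n - 1) u) * (du (x\<^sub>h S n) u \<bullet> du \<psi> u)) = 0)"

definition rotation_eq :: "rod_data \<Rightarrow> rod_fields \<Rightarrow> nat \<Rightarrow> bool" where
  "rotation_eq P S n \<longleftrightarrow> (\<forall>v\<in>V\<^sub>h P.
     - integral {0..1} (\<lambda>u. Krot P * m\<^sub>h S n u * v u * speed S (n - 1) u)
     - integral {0..1} (\<lambda>u. z\<^sub>h S n u * du v u)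
     + integral {0..1} (\<lambda>u. (y\<^sub>h S (n - 1) u \<bullet> (\<tau>tilde\<^sub>n P S (n - 1) u \<times> \<kappa>\<^sub>h S (n - 1) u))
         * v u * speed S (n - 1) u) = 0)"

definition twisting_integrand :: "rod_data \<Rightarrow> rod_fields \<Rightarrow> nat \<Rightarrow> (real \<Rightarrow> real) \<Rightarrow> real \<Rightarrow> real" where
  "twisting_integrand P S n q u =
     (z\<^sub>h S n u - Ccoef P u * (\<gamma>\<^sub>h S n u - \<gamma>0 P u (time P n)) - Dcoef P u * bdiff P (\<gamma>\<^sub>h S) n u)
     * q u * speed S (n - 1) u"

definition twisting_eq :: "rod_data \<Rightarrow> rod_fields \<Rightarrow> nat \<Rightarrow> bool" where
  "twisting_eq P S n \<longleftrightarrow> (\<forall>q\<in>Q\<^sub>h P.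
     twisting_integrand P S n q absolutely_integrable_on {0..1} \<and>
     integral {0..1} (twisting_integrand P S n q) = 0)"

definition twist_eq :: "rod_data \<Rightarrow> rod_fields \<Rightarrow> nat \<Rightarrow> bool" where
  "twist_eq P S n \<longleftrightarrow> (\<forall>q\<in>Q\<^sub>h P.
     integral {0..1} (\<lambda>u. bdiff P (\<gamma>\<^sub>h S) n u * q u * speed S (n - 1) u)
     - integral {0..1} (\<lambda>u. du (m\<^sub>h S n) u * q u)
     + integral {0..1} (\<lambda>u. ((\<tau>\<^sub>n S (n - 1) u \<times> \<kappa>\<^sub>h S (n - 1) u)
         \<bullet> bdiff P (\<lambda>k. du (x\<^sub>h S k)) n u) * q u) = 0)"

definition constraint_eq :: "rod_data \<Rightarrow> rod_fields \<Rightarrow> nat \<Rightarrow> bool" where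
  "constraint_eq P S n \<longleftrightarrow> (\<forall>q\<in>Q\<^sub>h P.
     integral {0..1} (\<lambda>u. q u * (\<tau>\<^sub>n S (n - 1) u \<bullet> du (x\<^sub>h S n) u))
     = integral {0..1} (\<lambda>u. speed S 0 u * q u))"

text \<open>
  \<open>transport t t' e\<close> rotates \<open>e\<close> by the minimal rotation taking the unit vector \<open>t\<close> to \<open>t'\<close>;
  \<open>rodrigues l \<theta> e\<close> rotates \<open>e\<close> about the axis \<open>l\<close> by the angle \<open>\<theta>\<close>.
\<close>

definition transport :: "real^3 \<Rightarrow> real^3 \<Rightarrow> real^3 \<Rightarrow> real^3" where
  "transport t t' e = (let k = t \<times> t' in
     (t \<bullet> t') *\<^sub>R e + k \<times> e + ((e \<bullet> k) / (1 + t \<bullet> t')) *\<^sub>R k)"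

definition rodrigues :: "real^3 \<Rightarrow> real \<Rightarrow> real^3 \<Rightarrow> real^3" where
  "rodrigues l \<theta> e = cos \<theta> *\<^sub>R e + sin \<theta> *\<^sub>R (l \<times> e) + ((e \<bullet> l) * (1 - cos \<theta>)) *\<^sub>R l"

definition frame_update :: "rod_data \<Rightarrow> rod_fields \<Rightarrow> nat \<Rightarrow> (nat \<Rightarrow> real \<Rightarrow> real^3) \<Rightarrow> bool" where
  "frame_update P S n e \<longleftrightarrow> (\<forall>i\<in>{1..N P}. let u = node P i in
     e n u = rodrigues (\<tau>tilde\<^sub>n P S n u) (\<Delta>t P * m\<^sub>h S n u)
               (transport (\<tau>tilde\<^sub>n P S (n - 1) u) (\<tau>tilde\<^sub>n P S n u) (e (n - 1) u)))"

definition regular :: "rod_data \<Rightarrow> rod_fields \<Rightarrow> nat \<Rightarrow> bool" where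
  "regular P S n \<longleftrightarrow> (\<forall>i\<in>{1..<N P}. \<forall>u\<in>elem P i. 0 < speed S n u)"

definition discrete_solution :: "rod_data \<Rightarrow> rod_fields \<Rightarrow> bool" where
  "discrete_solution P S \<longleftrightarrow>
     initial_values P S \<and> regular P S 0 \<and>
     (\<forall>n\<in>{1..M P}.
        in_spaces P S n \<and> regular P S n \<and>
        momentum_eq P S n \<and> bending_eq P S n \<and> curvature_eq P S n \<and>
        rotation_eq P S n \<and> twisting_eq P S n \<and> twist_eq P S n \<and>
        constraint_eq P S n \<and>
        frame_update P S n (e1\<^sub>h S) \<and> frame_update P S n (e2\<^sub>h S))"

end

theory Submission
  imports Defs
begin

text \<open>
  The length formula comes from the inextensibility constraint. The derivative of a function
  in \<open>V\<^sub>h P\<close> is constant on every element, so testing the constraint with the indicator of an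
  element turns it into a pointwise identity there (\<open>constant_eq_if_Q\<^sub>h_tests_agree\<close>):
  \<open>\<tau>\<^sup>n\<^sup>-\<^sup>1 \<bullet> x\<^sub>u\<^sup>n = |x\<^sub>u\<^sup>0|\<close>. With \<open>x\<^sub>u\<^sup>n = |x\<^sub>u\<^sup>n| \<tau>\<^sup>n\<close> this reads
  \<open>|x\<^sub>u\<^sup>n| (\<tau>\<^sup>n\<^sup>-\<^sup>1 \<bullet> \<tau>\<^sup>n) = |x\<^sub>u\<^sup>0|\<close>. For unit vectors the inner product is
  \<open>1 - |\<tau>\<^sup>n - \<tau>\<^sup>n\<^sup>-\<^sup>1|\<^sup>2 / 2\<close>, a number which is at most \<open>1\<close>, and positive by the assumption on the
  rotation of the tangent during one step. Dividing by it gives the equality, and since it is at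
  most \<open>1\<close>, the inequality.
\<close>

lemma node_less:
  assumes "valid_mesh P" "1 \<le> i" "i < j" "j \<le> N P"
  shows "node P i < node P j"
  using assms by (auto simp: valid_mesh_def strict_mono_on_def)

lemma node_le:
  assumes "valid_mesh P" "1 \<le> i" "i \<le> j" "j \<le> N P"
  shows "node P i \<le> node P j"
  using node_less[of P i j] assms by (cases "i = j") auto

lemma elem_subset_unit_interval:
  assumes "valid_mesh P" "i \<in> {1..<N P}"
  shows "elem P i \<subseteq> {0..1}"
  using node_le[of P 1 i] node_le[of P "Suc i" "N P"] assms
  by (auto simp: elem_def valid_mesh_def)

lemma elem_disjoint:
  assumes "valid_mesh P" "i \<in> {1..<N P}" "j \<in> {1..<N P}" "i \<noteq> j"
  shows "elem P i \<inter> elem P j = {}"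
  using node_le[of P "Suc i" j] node_le[of P "Suc j" i] assms
  by (cases "i < j") (auto simp: elem_def)

lemma du_constant_on_elem:
  assumes "v \<in> V\<^sub>h P" "i \<in> {1..<N P}"
  obtains b where "\<And>u. u \<in> elem P i \<Longrightarrow> du v u = b"
proof -
  obtain a b where ab: "\<And>u. u \<in> {node P i..node P (Suc i)} \<Longrightarrow> v u = a + u *\<^sub>R b"
    using assms unfolding V\<^sub>h_def by blast
  have "du v u = b" if u: "u \<in> elem P i" for u
  proof -
    have "((\<lambda>s. a + s *\<^sub>R b) has_vector_derivative b) (at u)"
      by (auto intro!: derivative_eq_intros)
    then have "(v has_vector_derivative b) (at u)"
      by (rule has_vector_derivative_transform_within_open[where S = "elem P i"])
         (use u ab in \<open>auto simp: elem_def\<close>)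
    then show ?thesis
      by (simp add: du_def vector_derivative_at)
  qed
  then show ?thesis by (rule that)
qed

lemma indicator_elem_in_Q\<^sub>h:
  assumes "valid_mesh P" "i \<in> {1..<N P}"
  shows "(indicator (elem P i) :: real \<Rightarrow> real) \<in> Q\<^sub>h P"
  unfolding Q\<^sub>h_def
proof (intro CollectI ballI)
  fix j assume "j \<in> {1..<N P}"
  then show "\<exists>c. \<forall>u\<in>elem P j. indicator (elem P i) u = (c::real)"
    using elem_disjoint[OF assms, of j]
    by (cases "j = i") (auto simp: indicator_def)
qed

lemma integral_indicator_elem:
  fixes f :: "real \<Rightarrow> real"
  assumes "valid_mesh P" "i \<in> {1..<N P}" "\<And>u. u \<in> elem P i \<Longrightarrow> f u = c"
  shows "integral {0..1} (\<lambda>u. indicator (elem P i) u * f u) = c * (node P (Suc i) - node P i)"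
proof -
  have "integral {0..1} (\<lambda>u. indicator (elem P i) u * f u)
      = integral {0..1} (\<lambda>u. if u \<in> elem P i then c else 0)"
    using assms(3) by (intro arg_cong[where f = "integral {0..1}"]) (auto simp: indicator_def)
  also have "\<dots> = integral (elem P i) (\<lambda>u. c)"
    using elem_subset_unit_interval[OF assms(1,2)]
    by (simp add: integral_restrict_Int Int_absorb2 Int_absorb1)
  also have "\<dots> = integral {node P i..node P (Suc i)} (\<lambda>u. c)"
    using integral_open_interval_real[of "node P i" "node P (Suc i)" "\<lambda>u. c"]
    by (simp add: elem_def)
  also have "\<dots> = c * (node P (Suc i) - node P i)"
    using node_less[of P i "Suc i"] assms(1,2) by simp
  finally show ?thesis .
qed

text \<open>
  The indicator of the element is an admissible test function. It reduces both integrals to the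
  constant values times the length of the element, which is positive.
\<close>

lemma constant_eq_if_Q\<^sub>h_tests_agree:
  fixes f g :: "real \<Rightarrow> real"
  assumes "valid_mesh P" "i \<in> {1..<N P}"
    and "\<And>q. q \<in> Q\<^sub>h P \<Longrightarrow> integral {0..1} (\<lambda>u. q u * f u) = integral {0..1} (\<lambda>u. q u * g u)"
    and "\<And>u. u \<in> elem P i \<Longrightarrow> f u = c" "\<And>u. u \<in> elem P i \<Longrightarrow> g u = d"
  shows "c = d"
proof -
  have "c * (node P (Suc i) - node P i) = d * (node P (Suc i) - node P i)"
    using assms(3)[OF indicator_elem_in_Q\<^sub>h[OF assms(1,2)]]
      integral_indicator_elem[OF assms(1,2), of f c, OF assms(4)]
      integral_indicator_elem[OF assms(1,2), of g d, OF assms(5)]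
    by simp
  then show ?thesis
    using node_less[of P i "Suc i"] assms(1,2) by simp
qed

lemma inner_unit_vectors:
  fixes s t :: "'a::real_inner"
  assumes "norm s = 1" "norm t = 1"
  shows "s \<bullet> t = 1 - 1/2 * (norm (t - s))\<^sup>2"
  using assms by (simp add: norm_eq_1 power2_norm_eq_inner inner_diff inner_commute field_simps)

lemma constraint_on_elem:
  assumes "valid_mesh P" "constraint_eq P S n"
    and "x\<^sub>h S 0 \<in> V\<^sub>h P" "x\<^sub>h S (n - 1) \<in> V\<^sub>h P" "x\<^sub>h S n \<in> V\<^sub>h P"
    and i: "i \<in> {1..<N P}" and u: "u \<in> elem P i"
  shows "\<tau>\<^sub>n S (n - 1) u \<bullet> du (x\<^sub>h S n) u = norm (du (x\<^sub>h S 0) u)"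
proof -
  obtain b0 where b0: "\<And>u. u \<in> elem P i \<Longrightarrow> du (x\<^sub>h S 0) u = b0"
    using du_constant_on_elem[OF assms(3) i] by blast
  obtain b1 where b1: "\<And>u. u \<in> elem P i \<Longrightarrow> du (x\<^sub>h S (n - 1)) u = b1"
    using du_constant_on_elem[OF assms(4) i] by blast
  obtain b2 where b2: "\<And>u. u \<in> elem P i \<Longrightarrow> du (x\<^sub>h S n) u = b2"
    using du_constant_on_elem[OF assms(5) i] by blast
  have "(b1 /\<^sub>R norm b1) \<bullet> b2 = norm b0"
  proof (rule constant_eq_if_Q\<^sub>h_tests_agree[OF assms(1) i])
    show "integral {0..1} (\<lambda>u. q u * (\<tau>\<^sub>n S (n - 1) u \<bullet> du (x\<^sub>h S n) u))
        = integral {0..1} (\<lambda>u. q u * speed S 0 u)" if "q \<in> Q\<^sub>h P" for q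
      using assms(2) that by (simp add: constraint_eq_def mult.commute)
  qed (simp_all add: \<tau>\<^sub>n_def \<tau>\<^sub>h_def speed_def b0 b1 b2 del: One_nat_def)
  then show ?thesis
    by (simp add: \<tau>\<^sub>n_def \<tau>\<^sub>h_def b0 b1 b2 u del: One_nat_def)
qed

theorem lemma7:
  fixes P :: rod_data and S :: rod_fields and n :: nat
  assumes "valid_data P"
    and "1 \<le> n" and "n \<le> M P"
    and "discrete_solution P S"
    and "\<forall>i\<in>{1..<N P}. \<forall>u\<in>elem P i. (norm (\<tau>\<^sub>n S n u - \<tau>\<^sub>n S (n - 1) u))\<^sup>2 < 2"
  shows "\<forall>i\<in>{1..<N P}. \<forall>u\<in>elem P i.
      norm (du (x\<^sub>h S 0) u) \<le> norm (du (x\<^sub>h S n) u) \<and>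
      norm (du (x\<^sub>h S n) u) =
        norm (du (x\<^sub>h S 0) u) / (1 - 1/2 * (norm (\<tau>\<^sub>n S n u - \<tau>\<^sub>n S (n - 1) u))\<^sup>2)"
proof (intro ballI)
  fix i u assume i: "i \<in> {1..<N P}" and u: "u \<in> elem P i"
  have mesh: "valid_mesh P"
    using assms(1) by (simp add: valid_data_def)
  (* Level 0 carries only initial data, so it has to be treated apart from the time steps. *)
  have level: "x\<^sub>h S k \<in> V\<^sub>h P \<and> regular P S k" if "k \<le> M P" for k
    using assms(4) that
    by (cases "k = 0") (auto simp: discrete_solution_def initial_values_def in_spaces_def)
  have pos: "0 < norm (du (x\<^sub>h S k) u)" if "k \<le> M P" for k
    using level[OF that] i u by (auto simp: regular_def speed_def)
  have unit: "norm (\<tau>\<^sub>n S k u) = 1" if "k \<le> M P" for k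
    using pos[OF that] by (simp add: \<tau>\<^sub>n_def \<tau>\<^sub>h_def)
  define c where "c = 1 - 1/2 * (norm (\<tau>\<^sub>n S n u - \<tau>\<^sub>n S (n - 1) u))\<^sup>2"
  have c: "0 < c" "c \<le> 1"
    using assms(5) i u by (auto simp: c_def)
  have "\<tau>\<^sub>n S (n - 1) u \<bullet> \<tau>\<^sub>n S n u = c"
    unfolding c_def using unit[of n] unit[of "n - 1"] assms(3)
    by (intro inner_unit_vectors) auto
  moreover have "du (x\<^sub>h S n) u = norm (du (x\<^sub>h S n) u) *\<^sub>R \<tau>\<^sub>n S n u"
    using pos[OF assms(3)] by (simp add: \<tau>\<^sub>n_def \<tau>\<^sub>h_def)
  ultimately have "\<tau>\<^sub>n S (n - 1) u \<bullet> du (x\<^sub>h S n) u = norm (du (x\<^sub>h S n) u) * c"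
    by (metis inner_scaleR_right)
  moreover have "\<tau>\<^sub>n S (n - 1) u \<bullet> du (x\<^sub>h S n) u = norm (du (x\<^sub>h S 0) u)"
    using assms(2-4) level[of 0] level[of "n - 1"] level[of n] i u
    by (intro constraint_on_elem[OF mesh]) (auto simp: discrete_solution_def)
  ultimately have len: "norm (du (x\<^sub>h S 0) u) = norm (du (x\<^sub>h S n) u) * c"
    by simp
  have "norm (du (x\<^sub>h S 0) u) \<le> norm (du (x\<^sub>h S n) u)"
    unfolding len using c(2) by (simp add: mult_left_le)
  moreover have "norm (du (x\<^sub>h S n) u) = norm (du (x\<^sub>h S 0) u) / c"
    using len c(1) by simp
  ultimately show "norm (du (x\<^sub>h S 0) u) \<le> norm (du (x\<^sub>h S n) u) \<and>
      norm (du (x\<^sub>h S n) u) =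
        norm (du (x\<^sub>h S 0) u) / (1 - 1/2 * (norm (\<tau>\<^sub>n S n u - \<tau>\<^sub>n S (n - 1) u))\<^sup>2)"
    by (simp add: c_def)
qed

end
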